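(* Let $t\geq 1$ be an integer and let $G$ be a connected conference graph, i.e. a $(4t+1,2t,t-1,t)$-SRG. Then Brouwer's Conjecture is true for $G$: if $S$ is a disconnecting set of $G$ such that every component of $G\setminus S$ has at least two vertices, then $|S|\geq 2k-\lambda-2$, where $k=2t$ and $\lambda=t-1$.
   Context: All graphs are finite and simple. A graph $G$ is a $(v,k,\lambda,\mu)$-SRG (strongly regular graph) if it has $v$ vertices, is $k$-regular, any two adjacent vertices have exactly $\lambda$ common neighbors, and any two distinct non-adjacent vertices have exactly $\mu$ common neighbors. A disconnecting set of a connected graph $G$ is a set $S$ of vertices such that $G\setminus S$ is disconnected. *)

theory Defs
  imports Complex_Main "Graph_Theory.Digraph_Component"
begin

text \<open>Finite simple graphs are the library's \<^locale>\<open>graph\<close>: finite, loop-free digraphs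
  without parallel arcs whose adjacency relation is symmetric.\<close>

definition common_neighbors :: "('a, 'b) pre_digraph \<Rightarrow> 'a \<Rightarrow> 'a \<Rightarrow> 'a set" where
  "common_neighbors G x y = {z \<in> verts G. x \<rightarrow>\<^bsub>G\<^esub> z \<and> y \<rightarrow>\<^bsub>G\<^esub> z}"

text \<open>An undirected edge is a pair of opposite arcs, so the degree of a vertex is its
  \<^const>\<open>out_degree\<close>.\<close>

definition srg :: "('a, 'b) pre_digraph \<Rightarrow> nat \<Rightarrow> nat \<Rightarrow> nat \<Rightarrow> nat \<Rightarrow> bool" where
  "srg G v k lam mu \<longleftrightarrow>
     graph G \<and>
     card (verts G) = v \<and>
     (\<forall>x \<in> verts G. out_degree G x = k) \<and>
     (\<forall>x \<in> verts G. \<forall>y \<in> verts G. x \<rightarrow>\<^bsub>G\<^esub> y \<longrightarrow> card (common_neighbors G x y) = lam) \<and>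
     (\<forall>x \<in> verts G. \<forall>y \<in> verts G.
        x \<noteq> y \<and> \<not> x \<rightarrow>\<^bsub>G\<^esub> y \<longrightarrow> card (common_neighbors G x y) = mu)"

definition delete_verts :: "('a, 'b) pre_digraph \<Rightarrow> 'a set \<Rightarrow> ('a, 'b) pre_digraph" where
  "delete_verts G S = G \<restriction> (verts G - S)"

text \<open>The library does not count the null graph as connected, so the whole vertex set is a
  disconnecting set here.\<close>

definition disconnecting_set :: "('a, 'b) pre_digraph \<Rightarrow> 'a set \<Rightarrow> bool" where
  "disconnecting_set G S \<longleftrightarrow>
     S \<subseteq> verts G \<and> \<not> Digraph_Component.connected (delete_verts G S)"

text \<open>For a symmetric digraph, the strongly connected components are the connected components
  of the underlying undirected graph.\<close>

abbreviation graph_components :: "('a, 'b) pre_digraph \<Rightarrow> ('a, 'b) pre_digraph set" where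
  "graph_components G \<equiv> pre_digraph.sccs G"

end

theory Submission
  imports Defs "HOL-Analysis.Convex"
begin

text \<open>Let \<open>A\<close> be a component of \<open>G - S\<close> and \<open>B\<close> the rest of it.
  An edge inside \<open>A\<close> dominates \<open>3t + 1\<close> vertices, none of them in \<open>B\<close>, so \<open>|B| \<le> t\<close>, and
  symmetrically \<open>|A| \<le> t\<close>. The only eigenvalues of \<open>2 Adj + I\<close> apart from the principal one are
  \<open>\<plusminus>\<surd>(4t + 1)\<close>, which gives the expander mixing bound \<open>4t |A| |B| \<le> (4t + 1) |S|\<close>.
  If \<open>|S| \<le> 3t - 2\<close>, then \<open>|A| + |B| \<ge> t + 3\<close>, so the first bounds force \<open>|A|, |B| \<ge> 3\<close>;
  hence \<open>|A| |B| \<ge> 3 (|A| + |B|) - 9 \<ge> 3t\<close>, against the mixing bound.\<close>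

section \<open>The mixing bound\<close>

text \<open>Instead of eigenvalues, apply Cauchy--Schwarz on \<open>V - B\<close> to the vector
  \<open>(2 Adj + I) 1\<^sub>A\<close>, which vanishes on \<open>B\<close>; the Gram condition on the columns of \<open>e\<close> is
  the identity \<open>Adj\<^sup>2 = t J + t I - Adj\<close>.\<close>

lemma conference_mixing_bound:
  fixes e :: "'a \<Rightarrow> 'a \<Rightarrow> real" and t :: real
  assumes "finite V" "A \<subseteq> V" "B \<subseteq> V" "A \<inter> B = {}" "A \<noteq> {}"
    and card_V: "real (card V) = 4 * t + 1"
    and col: "\<And>y. y \<in> A \<Longrightarrow> (\<Sum>x\<in>V. e x y) = 2 * t"
    and gram: "\<And>y z. y \<in> A \<Longrightarrow> z \<in> A \<Longrightarrow>
      (\<Sum>x\<in>V. e x y * e x z) = t + (if y = z then t else 0) - e y z"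
    and sep: "\<And>x y. x \<in> B \<Longrightarrow> y \<in> A \<Longrightarrow> e x y = 0"
  shows "4 * t * (real (card A) * real (card B))
    \<le> (4 * t + 1) * (4 * t + 1 - real (card A) - real (card B))"
proof -
  define a b where "a = real (card A)" and "b = real (card B)"
  define d where "d x = (\<Sum>y\<in>A. e x y)" for x
  define i :: "'a \<Rightarrow> real" where "i x = (if x \<in> A then 1 else 0)" for x
  define g where "g x = 2 * d x + i x" for x
  have fin: "finite A" "finite B"
    using assms finite_subset by blast+
  have a_pos: "a > 0"
    using fin assms by (simp add: a_def card_gt_0_iff)
  have sum_d: "(\<Sum>x\<in>V. d x) = 2 * t * a"
    unfolding d_def by (subst sum.swap) (simp add: col a_def)
  have sum_i: "(\<Sum>x\<in>V. f x * i x) = (\<Sum>x\<in>A. f x)" for f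
  proof -
    have "(\<Sum>x\<in>V. f x * i x) = (\<Sum>x\<in>A. f x * i x)"
      by (rule sum.mono_neutral_right) (use assms in \<open>auto simp: i_def\<close>)
    then show ?thesis
      by (simp add: i_def)
  qed
  have sum_d2: "(\<Sum>x\<in>V. (d x)\<^sup>2) = a\<^sup>2 * t + a * t - (\<Sum>y\<in>A. d y)"
  proof -
    have "(\<Sum>x\<in>V. (d x)\<^sup>2) = (\<Sum>x\<in>V. \<Sum>y\<in>A. \<Sum>z\<in>A. e x y * e x z)"
      by (simp add: d_def power2_eq_square sum_product)
    also have "\<dots> = (\<Sum>y\<in>A. \<Sum>z\<in>A. \<Sum>x\<in>V. e x y * e x z)"
      by (subst sum.swap) (rule sum.cong[OF refl sum.swap])
    also have "\<dots> = (\<Sum>y\<in>A. \<Sum>z\<in>A. t + (if y = z then t else 0) - e y z)"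
      by (intro sum.cong refl gram)
    also have "\<dots> = a\<^sup>2 * t + a * t - (\<Sum>y\<in>A. d y)"
      using fin by (simp add: d_def a_def sum.distrib sum_subtractf power2_eq_square algebra_simps)
    finally show ?thesis .
  qed
  have g_B: "g x = 0" if "x \<in> B" for x
    using that assms by (auto simp: g_def d_def i_def)
  \<comment> \<open>Dropping \<open>B\<close> leaves both sums unchanged but shrinks the
    Cauchy--Schwarz factor from \<open>4 * t + 1\<close> to \<open>4 * t + 1 - b\<close>; this is
    the whole gain.\<close>
  have restrict: "(\<Sum>x\<in>V - B. f (g x)) = (\<Sum>x\<in>V. f (g x))" if "f 0 = 0" for f :: "real \<Rightarrow> real"
    by (rule sum.mono_neutral_left) (use assms g_B that in auto)
  have sum_g: "(\<Sum>x\<in>V. g x) = a * (4 * t + 1)"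
    using sum_i[of "\<lambda>_. 1"]
    by (simp add: g_def sum.distrib flip: sum_distrib_left)
      (simp add: sum_d a_def algebra_simps)
  have sum_g2: "(\<Sum>x\<in>V. (g x)\<^sup>2) = a * (4 * t * (a + 1) + 1)"
  proof -
    have "(g x)\<^sup>2 = 4 * (d x)\<^sup>2 + 4 * (d x * i x) + 1 * i x" for x
      by (simp add: g_def i_def power2_eq_square algebra_simps)
    then have "(\<Sum>x\<in>V. (g x)\<^sup>2)
        = 4 * (\<Sum>x\<in>V. (d x)\<^sup>2) + 4 * (\<Sum>x\<in>V. d x * i x) + (\<Sum>x\<in>V. 1 * i x)"
      by (simp only: sum.distrib sum_distrib_left)
    \<comment> \<open>The sum of \<open>d\<close> over \<open>A\<close> cancels:
      \<open>sum_d2\<close> contributes it with coefficient -4, the cross term with +4. This is why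
      \<open>g\<close> gives \<open>d\<close> the weight 2.\<close>
    also have "\<dots> = a * (4 * t * (a + 1) + 1)"
      unfolding sum_i sum_d2 by (simp add: a_def power2_eq_square algebra_simps)
    finally show ?thesis .
  qed
  have "card B \<le> card V"
    using assms by (simp add: card_mono)
  then have card_diff: "real (card (V - B)) = 4 * t + 1 - b"
    using assms fin by (simp add: card_Diff_subset of_nat_diff b_def)
  have "(\<Sum>x\<in>V - B. g x)\<^sup>2 \<le> (\<Sum>x\<in>V - B. (g x)\<^sup>2) * real (card (V - B))"
    by (rule sum_squared_le_sum_of_squares)
  then have "a * (a * (4 * t + 1)\<^sup>2) \<le> a * ((4 * t * (a + 1) + 1) * (4 * t + 1 - b))"
    unfolding card_diff restrict[of "\<lambda>x. x", OF refl] sum_g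
      restrict[of "\<lambda>x. x\<^sup>2", OF zero_power2] sum_g2
    by (simp add: power2_eq_square algebra_simps)
  then have "a * (4 * t + 1)\<^sup>2 \<le> (4 * t * (a + 1) + 1) * (4 * t + 1 - b)"
    using a_pos by simp
  \<comment> \<open>An exact rearrangement: \<open>4 * t * a * (4 * t + 1)\<close> occurs on both
    sides and cancels.\<close>
  then show ?thesis
    by (simp add: a_def b_def power2_eq_square algebra_simps)
qed

section \<open>Neighbourhoods\<close>

definition neighborhood :: "('a, 'b) pre_digraph \<Rightarrow> 'a \<Rightarrow> 'a set" where
  "neighborhood G x = {y. x \<rightarrow>\<^bsub>G\<^esub> y}"

lemma (in digraph) card_neighborhood: "card (neighborhood G x) = out_degree G x"
proof -
  have "neighborhood G x = head G ` out_arcs G x"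
    by (auto simp: neighborhood_def arcs_ends_conv)
  moreover have "inj_on (head G) (out_arcs G x)"
    using no_multi_arcs by (auto simp: inj_on_def arc_to_ends_def)
  ultimately show ?thesis
    by (simp add: card_image out_degree_def)
qed

lemma (in wf_digraph) neighborhood_subset: "neighborhood G x \<subseteq> verts G"
  by (auto simp: neighborhood_def adj_in_verts)

lemma (in wf_digraph) common_neighbors_eq:
  "common_neighbors G x y = neighborhood G x \<inter> neighborhood G y"
  by (auto simp: common_neighbors_def neighborhood_def adj_in_verts)

text \<open>By inclusion-exclusion the neighbourhoods of the two ends of an edge cover exactly
  \<open>2 * k - lam\<close> vertices, all outside \<open>B\<close>.\<close>

lemma (in graph) edge_excludes:
  assumes reg: "\<And>x. x \<in> verts G \<Longrightarrow> out_degree G x = k"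
    and "x \<rightarrow> y" and lam: "card (common_neighbors G x y) = lam"
    and B: "B \<subseteq> verts G" "\<And>z. z \<in> B \<Longrightarrow> \<not> x \<rightarrow> z" "\<And>z. z \<in> B \<Longrightarrow> \<not> y \<rightarrow> z"
  shows "card B + 2 * k \<le> card (verts G) + lam"
proof -
  let ?N = "neighborhood G x \<union> neighborhood G y"
  have xy: "x \<in> verts G" "y \<in> verts G"
    using \<open>x \<rightarrow> y\<close> adj_in_verts by auto
  have fin: "finite (neighborhood G z)" for z
    using neighborhood_subset finite_verts by (rule finite_subset)
  have "card ?N + lam = 2 * k"
    using card_Un_Int[OF fin fin, of x y] xy
    by (simp add: card_neighborhood reg lam flip: common_neighbors_eq)
  moreover have "card B + card ?N = card (B \<union> ?N)"
    using B fin finite_subset[OF B(1)]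
    by (intro card_Un_disjoint[symmetric]) (auto simp: neighborhood_def)
  moreover have "card (B \<union> ?N) \<le> card (verts G)"
    using B neighborhood_subset by (intro card_mono) auto
  ultimately show ?thesis
    by linarith
qed

text \<open>The srg parameters supply the column sums and the Gram identity. The bound is moved to
  integers because the final argument replaces \<open>s < 3 * t - 1\<close> by
  \<open>s \<le> 3 * t - 2\<close>.\<close>

lemma (in graph) conference_graph_mixing:
  assumes srg: "srg G (4 * t + 1) (2 * t) (t - 1) t" and "t \<ge> 1"
    and AB: "A \<subseteq> verts G" "B \<subseteq> verts G" "A \<inter> B = {}" "A \<noteq> {}"
    and sep: "\<And>x y. x \<in> A \<Longrightarrow> y \<in> B \<Longrightarrow> \<not> x \<rightarrow> y"
  shows "4 * int t * (int (card A) * int (card B))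
    \<le> (4 * int t + 1) * (4 * int t + 1 - int (card A) - int (card B))"
proof -
  \<comment> \<open>Column \<open>y\<close> is the indicator of the out-neighbourhood of
    \<open>y\<close>, so column sums are out-degrees and \<open>sep\<close> applies without invoking
    symmetry.\<close>
  define e :: "'a \<Rightarrow> 'a \<Rightarrow> real" where "e x y = of_bool (y \<rightarrow> x)" for x y
  have sum_of_bool: "(\<Sum>x\<in>verts G. of_bool (P x)) = real (card {x \<in> verts G. P x})" for P
    by (simp add: sum.If_cases of_bool_def Int_def)
  have nbh: "{x \<in> verts G. y \<rightarrow> x} = neighborhood G y" for y
    by (auto simp: neighborhood_def adj_in_verts)
  have col: "(\<Sum>x\<in>verts G. e x y) = 2 * real t" if "y \<in> A" for y
    unfolding e_def sum_of_bool nbh card_neighborhood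
    using srg AB that by (auto simp: srg_def)
  have gram: "(\<Sum>x\<in>verts G. e x y * e x z) = real t + (if y = z then real t else 0) - e y z"
    if "y \<in> A" "z \<in> A" for y z
  proof -
    have yz: "y \<in> verts G" "z \<in> verts G"
      using that AB by auto
    have "(\<Sum>x\<in>verts G. e x y * e x z) = (\<Sum>x\<in>verts G. of_bool (y \<rightarrow> x \<and> z \<rightarrow> x))"
      by (simp add: e_def of_bool_conj)
    also have "\<dots> = real (card (common_neighbors G z y))"
      unfolding sum_of_bool common_neighbors_def by (simp add: conj_commute)
    also have "\<dots> = real t + (if y = z then real t else 0) - e y z"
    \<comment> \<open>The entries are the degree \<open>2 * t\<close> on the diagonal,
      \<open>t - 1\<close> for adjacent and \<open>t\<close> for distinct non-adjacent vertices;
      \<open>t \<ge> 1\<close> keeps the natural subtraction exact.\<close>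
    proof (cases "y = z")
      case True
      then have "card (common_neighbors G z y) = 2 * t"
        using srg yz by (simp add: common_neighbors_eq card_neighborhood srg_def)
      moreover have "\<not> z \<rightarrow> y"
        using True adj_not_same by blast
      ultimately show ?thesis
        using True by (simp add: e_def)
    next
      case False
      then show ?thesis
        using srg yz \<open>t \<ge> 1\<close> by (auto simp: srg_def e_def of_nat_diff)
    qed
    finally show ?thesis .
  qed
  have "4 * real t * (real (card A) * real (card B))
    \<le> (4 * real t + 1) * (4 * real t + 1 - real (card A) - real (card B))"
    using srg sep
    by (intro conference_mixing_bound[where V = "verts G" and e = e] AB col gram)
      (auto simp: srg_def e_def)
  then have "real_of_int (4 * int t * (int (card A) * int (card B)))
    \<le> real_of_int ((4 * int t + 1) * (4 * int t + 1 - int (card A) - int (card B)))"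
    by simp
  then show ?thesis
    by (simp only: of_int_le_iff)
qed

section \<open>Splitting a disconnected graph\<close>

lemma (in wf_digraph) scc_of_has_edge:
  assumes "2 \<le> card (scc_of u)"
  obtains x where "u \<rightarrow> x" "u \<rightarrow>\<^sup>* x"
proof -
  have "\<not> scc_of u \<subseteq> {u}"
    using assms card_mono[of "{u}" "scc_of u"] by auto
  then obtain w where "u \<rightarrow>\<^sup>* w" "w \<noteq> u"
    by (auto simp: scc_of_def)
  then have "u \<rightarrow>\<^sup>+ w"
    using reachable_neq_reachable1 by blast
  then obtain x where "u \<rightarrow> x"
    by (rule converse_tranclE) blast+
  then show ?thesis
    using that by (auto intro: reachable_adjI)
qed

text \<open>\<open>A\<close> is the component of some \<open>u\<close> and \<open>B\<close>
  everything else. A vertex \<open>v\<close> not reachable from \<open>u\<close> has its whole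
  component in \<open>B\<close>, and the size condition gives both components an edge.\<close>

lemma (in sym_digraph) disconnected_split:
  assumes "verts G \<noteq> {}" "\<not> connected G"
    and comps: "\<forall>C \<in> sccs. 2 \<le> card (verts C)"
  obtains A B where "A \<union> B = verts G" "A \<inter> B = {}"
    "\<exists>x\<in>A. \<exists>y\<in>A. x \<rightarrow> y" "\<exists>x\<in>B. \<exists>y\<in>B. x \<rightarrow> y" "\<forall>x\<in>A. \<forall>y\<in>B. \<not> x \<rightarrow> y"
proof -
  obtain u v where uv: "u \<in> verts G" "v \<in> verts G" "\<not> u \<rightarrow>\<^sup>* v"
    using assms(1,2) connectedI reachable_mk_symmetric_eq[OF sym_arcs] by blast
  have big: "2 \<le> card (scc_of w)" if "w \<in> verts G" for w
    using comps scc_of_in_sccs_verts[OF that] by (auto simp: sccs_verts_conv)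
  have sub: "scc_of w \<subseteq> verts G" for w
    by (auto simp: scc_of_def reachable_in_verts)
  \<comment> \<open>Symmetry makes one-way reachability enough for membership in the
    component.\<close>
  have reach: "u \<rightarrow>\<^sup>* w \<longleftrightarrow> w \<in> scc_of u" for w
    using scc_ofI_reachable' by (auto simp: scc_of_def)
  define A where "A = scc_of u"
  define B where "B = verts G - A"
  have v_B: "scc_of v \<subseteq> B"
    using uv sub by (auto simp: A_def B_def scc_of_def intro: reachable_trans)
  obtain x where x: "u \<rightarrow> x" "u \<rightarrow>\<^sup>* x"
    using scc_of_has_edge[OF big[OF uv(1)]] .
  obtain y where y: "v \<rightarrow> y" "v \<rightarrow>\<^sup>* y"
    using scc_of_has_edge[OF big[OF uv(2)]] .
  show ?thesis
  proof
    show "A \<union> B = verts G" "A \<inter> B = {}"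
      using sub by (auto simp: A_def B_def)
    show "\<exists>x\<in>A. \<exists>y\<in>A. x \<rightarrow> y"
      using x in_scc_of_self[OF uv(1)] reach by (auto simp: A_def)
    have "y \<in> scc_of v"
      using y scc_ofI_reachable' by blast
    then show "\<exists>x\<in>B. \<exists>y\<in>B. x \<rightarrow> y"
      using y v_B in_scc_of_self[OF uv(2)] by blast
    have "y \<in> A" if "x \<in> A" "x \<rightarrow> y" for x y
      using that reach[of x] reach[of y] reachable_adj_trans[of u x y] by (simp add: A_def)
    then show "\<forall>x\<in>A. \<forall>y\<in>B. \<not> x \<rightarrow> y"
      by (auto simp: B_def)
  qed
qed

lemma mixing_arithmetic:
  fixes a b s t :: int
  assumes "4 * t + 1 = a + b + s"
    and "a \<le> t" "b \<le> t"
    and mix: "4 * t * (a * b) \<le> (4 * t + 1) * s"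
  shows "3 * t - 1 \<le> s"
proof (rule ccontr)
  assume "\<not> 3 * t - 1 \<le> s"
  then have s: "s \<le> 3 * t - 2" and ab: "3 \<le> a" "3 \<le> b" "t + 3 \<le> a + b"
    using assms by auto
  have "0 \<le> (a - 3) * (b - 3)"
    using ab by simp
  then have "3 * t \<le> a * b"
    using ab by (simp add: algebra_simps)
  then have "4 * t * (3 * t) \<le> 4 * t * (a * b)"
    using assms ab by (intro mult_left_mono) auto
  also have "\<dots> \<le> (4 * t + 1) * s"
    by (rule mix)
  also have "\<dots> \<le> (4 * t + 1) * (3 * t - 2)"
    using s assms ab by (intro mult_left_mono) auto
  \<comment> \<open>The right side is \<open>12 * t\<^sup>2 - 5 * t - 2\<close>, which is below
    \<open>12 * t\<^sup>2\<close> because \<open>t \<ge> a \<ge> 3\<close>.\<close>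
  finally show False
    using assms ab by (simp add: algebra_simps)
qed

theorem mainTheorem5:
  fixes G :: "('a, 'b) pre_digraph"
    and t k lam :: nat
    and S :: "'a set"
  assumes "t \<ge> 1"
    and "k = 2 * t"
    and "lam = t - 1"
    and "srg G (4 * t + 1) k lam t"
    and "Digraph_Component.connected G"
    and "disconnecting_set G S"
    and "\<forall>C \<in> graph_components (delete_verts G S). card (verts C) \<ge> 2"
  shows "int (card S) \<ge> 2 * int k - int lam - 2"
proof -
  have srg: "srg G (4 * t + 1) (2 * t) (t - 1) t"
    using assms by simp
  then interpret graph G
    by (simp add: srg_def)
  have card_V: "card (verts G) = 4 * t + 1"
    using srg by (simp add: srg_def)
  have S: "S \<subseteq> verts G" and disc: "\<not> connected (G \<restriction> (verts G - S))"
    using assms by (auto simp: disconnecting_set_def delete_verts_def)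
  interpret H: sym_digraph "G \<restriction> (verts G - S)"
    by (intro induced_graph_imp_graph induced_induce) simp
  \<comment> \<open>For \<open>k = 2 * t\<close> and \<open>lam = t - 1\<close>, the target
    \<open>2 * k - lam - 2\<close> equals \<open>3 * t - 1\<close>.\<close>
  have "3 * int t - 1 \<le> int (card S)"
  proof (cases "verts G - S = {}")
    \<comment> \<open>Nothing remains to be split here, but \<open>S\<close> then has
      \<open>4 * t + 1\<close> elements.\<close>
    case True
    then have "S = verts G"
      using S by blast
    then show ?thesis
      using card_V by simp
  next
    case False
    have ne: "verts (G \<restriction> (verts G - S)) \<noteq> {}"
      and comps: "\<forall>C \<in> H.sccs. 2 \<le> card (verts C)"
      using False assms(7) by (simp_all add: delete_verts_def)
    obtain A B where AB: "A \<union> B = verts (G \<restriction> (verts G - S))" "A \<inter> B = {}"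
      and A_edge: "\<exists>x\<in>A. \<exists>y\<in>A. x \<rightarrow>\<^bsub>G \<restriction> (verts G - S)\<^esub> y"
      and B_edge: "\<exists>x\<in>B. \<exists>y\<in>B. x \<rightarrow>\<^bsub>G \<restriction> (verts G - S)\<^esub> y"
      and sep_H: "\<forall>x\<in>A. \<forall>y\<in>B. \<not> x \<rightarrow>\<^bsub>G \<restriction> (verts G - S)\<^esub> y"
      using H.disconnected_split[OF ne disc comps] by blast
    have A: "A \<subseteq> verts G" and B: "B \<subseteq> verts G"
      using AB by auto
    \<comment> \<open>Non-adjacency lifts to \<open>G\<close> because the subgraph is
      induced.\<close>
    have sep: "\<not> x \<rightarrow>\<^bsub>G\<^esub> y" if "x \<in> A" "y \<in> B" for x y
      using sep_H that AB(1) by (auto simp: arcs_ends_conv)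
    then have sep': "\<not> y \<rightarrow>\<^bsub>G\<^esub> x" if "x \<in> A" "y \<in> B" for x y
      using that arcs_ends_symmetric[OF sym_arcs] by blast
    \<comment> \<open>The constant is \<open>(4 * t + 1) + (t - 1) - 4 * t = t\<close>.\<close>
    have excl: "card Y \<le> t"
      if "x \<rightarrow>\<^bsub>G\<^esub> y" "Y \<subseteq> verts G" "\<And>z. z \<in> Y \<Longrightarrow> \<not> x \<rightarrow>\<^bsub>G\<^esub> z" "\<And>z. z \<in> Y \<Longrightarrow> \<not> y \<rightarrow>\<^bsub>G\<^esub> z" for x y Y
    proof -
      have "card (common_neighbors G x y) = t - 1"
        using srg that(1) adj_in_verts by (auto simp: srg_def)
      then have "card Y + 2 * (2 * t) \<le> card (verts G) + (t - 1)"
        using srg that by (intro edge_excludes[of _ x y]) (auto simp: srg_def)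
      then show ?thesis
        using card_V \<open>t \<ge> 1\<close> by simp
    qed
    have "card B \<le> t"
      using A_edge excl[OF dominates_induce_subgraphD B] sep by blast
    moreover have "card A \<le> t"
      using B_edge excl[OF dominates_induce_subgraphD A] sep' by blast
    moreover have size: "4 * int t + 1 = int (card A) + int (card B) + int (card S)"
    proof -
      have "card (verts G) = card (verts G - S) + card S"
        using S by (metis add.commute card_Diff_subset card_mono finite_subset finite_verts
            le_add_diff_inverse)
      also have "card (verts G - S) = card A + card B"
        using A B AB
        by (metis card_Un_disjoint finite_subset finite_verts induce_subgraph_verts)
      finally show ?thesis
        using card_V by linarith
    qed
    moreover have "4 * int t * (int (card A) * int (card B)) \<le> (4 * int t + 1) * int (card S)"
    proof -
      have "4 * int t * (int (card A) * int (card B))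
          \<le> (4 * int t + 1) * (4 * int t + 1 - int (card A) - int (card B))"
        using AB A B A_edge sep \<open>t \<ge> 1\<close> by (intro conference_graph_mixing[OF srg]) auto
      also have "4 * int t + 1 - int (card A) - int (card B) = int (card S)"
        using size by linarith
      finally show ?thesis .
    qed
    ultimately show ?thesis
      by (intro mixing_arithmetic[of _ "int (card A)" "int (card B)"]) simp_all
  qed
  then show ?thesis
    using assms by (simp add: of_nat_diff)
qed

end
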